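(* Suppose all probability distributions involved are either discrete or have a density function. Let $D\ge 0$ be an integer. (1) Given any recovery problem of estimating a non-negative scalar quantity $g(X)$ from $Y$, where $(X,Y)\sim\mathbb{Q}$ and $0<\mathbb{E}_{\mathbb{Q}}[g(X)]<\infty$, there exists a joint distribution $(X,Y)\sim\mathbb{P}$ such that, for the planted testing problem $H_0: Y\sim\mathbb{Q}$ versus $H_1: Y\sim\mathbb{P}$, $$\mathsf{Adv}_{\le D}(\mathbb{P},\mathbb{Q})=\mathsf{Corr}'_{\le D}(g(X),\mathbb{Q}).$$ (2) Given a testing problem $H_0: Y\sim\mathbb{Q}$ versus $H_1: Y\sim\mathbb{P}$ between two planted distributions $(X,Y)\sim\mathbb{Q}$ and $(X,Y)\sim\mathbb{P}$, if the likelihood ratio of the signals $\ell(X):=d\mathbb{P}_X/d\mathbb{Q}_X$ exists and the conditional distribution $Y|X$ is the same under $\mathbb{P}$ and $\mathbb{Q}$, then for the problem of estimating $g(X)=\ell(X)$ in $\mathbb{Q}$, $$\mathsf{Adv}_{\le D}(\mathbb{P},\mathbb{Q})=\mathsf{Corr}'_{\le D}(g(X),\mathbb{Q}).$$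
   Context: Here $X$ is an (unobserved) signal and $Y\in\mathbb{R}^N$ is the observation; $\mathbb{P}$ and $\mathbb{Q}$ denote joint distributions of $(X,Y)$, and $\mathbb{P}_X,\mathbb{Q}_X$ the corresponding marginal distributions of $X$. Define $$\mathsf{Adv}_{\le D}(\mathbb{P},\mathbb{Q}):=\sup_{f}\frac{\mathbb{E}_{\mathbb{P}}[f(Y)]}{\sqrt{\mathbb{E}_{\mathbb{Q}}[f(Y)^2]}},\qquad \mathsf{Corr}'_{\le D}(g(X),\mathbb{Q}):=\frac{1}{\mathbb{E}_{\mathbb{Q}}[g(X)]}\,\sup_{f}\frac{\mathbb{E}_{\mathbb{Q}}[g(X)f(Y)]}{\sqrt{\mathbb{E}_{\mathbb{Q}}[f(Y)^2]}},$$ where in both cases $f$ ranges over polynomials $\mathbb{R}^N\to\mathbb{R}$ of degree at most $D$ (for which the quotient is well defined). *)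

theory Defs
  imports "HOL-Probability.Probability"
begin

text \<open>
  The signal \<open>X\<close> takes values in an arbitrary measure space \<open>S\<close>: its sigma-algebra makes the
  signals a measurable space, and its measure is the one with respect to which densities of
  signals are taken (e.g. \<open>lborel\<close> for Euclidean signals). The observation \<open>Y\<close> takes values in
  \<open>real ^ 'n\<close>, so \<open>N = CARD('n)\<close>. A joint law of \<open>(X, Y)\<close> is a measure on pairs, with
  \<open>X = fst\<close> and \<open>Y = snd\<close>.
\<close>

definition law_X :: "'a measure \<Rightarrow> ('a \<times> 'b) measure \<Rightarrow> 'a measure" where
  "law_X S J = distr J S fst"

definition law_Y :: "('a \<times> (real ^ 'n)) measure \<Rightarrow> (real ^ 'n) measure" where
  "law_Y J = distr J borel snd"

definition discrete_distr :: "'a measure \<Rightarrow> bool" where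
  "discrete_distr M \<longleftrightarrow>
     (\<exists>A. countable A \<and> (\<forall>a\<in>A. {a} \<in> sets M) \<and> (AE x in M. x \<in> A))"

definition discrete_or_density :: "'a measure \<Rightarrow> 'a measure \<Rightarrow> bool" where
  "discrete_or_density R M \<longleftrightarrow>
     discrete_distr M \<or> (\<exists>p\<in>borel_measurable R. M = density R p)"

text \<open>\<open>\<kappa>\<close> is a (regular) conditional distribution of \<open>Y\<close> given \<open>X\<close> under \<open>J\<close>.\<close>

definition cond_law ::
  "'a measure \<Rightarrow> ('a \<times> (real ^ 'n)) measure \<Rightarrow> ('a \<Rightarrow> (real ^ 'n) measure) \<Rightarrow> bool" where
  "cond_law S J \<kappa> \<longleftrightarrow>
     \<kappa> \<in> measurable S (prob_algebra borel) \<and>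
     (\<forall>A\<in>sets S. \<forall>B\<in>sets borel.
        emeasure J (A \<times> B) = (\<integral>\<^sup>+x\<in>A. emeasure (\<kappa> x) B \<partial>law_X S J))"

text \<open>
  The laws of \<open>X\<close>, of \<open>Y\<close>, and of \<open>Y\<close> given \<open>X = x\<close> are each discrete or have a density. The
  alternatives are chosen separately, so that e.g. a discrete signal observed in Gaussian noise,
  whose joint law is neither discrete nor absolutely continuous, is allowed.
\<close>

definition planted_distr :: "'a measure \<Rightarrow> ('a \<times> (real ^ 'n)) measure \<Rightarrow> bool" where
  "planted_distr S J \<longleftrightarrow>
     prob_space J \<and> sets J = sets (S \<Otimes>\<^sub>M borel) \<and>
     discrete_or_density S (law_X S J) \<and>
     discrete_or_density lborel (law_Y J) \<and>
     (\<exists>\<kappa>. cond_law S J \<kappa> \<and> (\<forall>x\<in>space S. discrete_or_density lborel (\<kappa> x)))"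

text \<open>\<open>l\<close> is a (finite, non-negative) version of \<open>dP\<^sub>X / dQ\<^sub>X\<close>.\<close>

definition likelihood_ratio_X ::
  "'a measure \<Rightarrow> ('a \<times> 'b) measure \<Rightarrow> ('a \<times> 'b) measure \<Rightarrow> ('a \<Rightarrow> real) \<Rightarrow> bool" where
  "likelihood_ratio_X S P Q l \<longleftrightarrow>
     l \<in> borel_measurable S \<and> (\<forall>x\<in>space S. 0 \<le> l x) \<and>
     law_X S P = density (law_X S Q) (\<lambda>x. ennreal (l x))"

definition multidegrees :: "nat \<Rightarrow> ('n::finite \<Rightarrow> nat) set" where
  "multidegrees D = {\<alpha>. (\<Sum>i\<in>UNIV. \<alpha> i) \<le> D}"

lemma finite_multidegrees: "finite (multidegrees D :: ('n::finite \<Rightarrow> nat) set)"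
proof (rule finite_subset)
  show "(multidegrees D :: ('n \<Rightarrow> nat) set) \<subseteq> (UNIV \<rightarrow>\<^sub>E {..D})"
  proof
    fix \<alpha> :: "'n \<Rightarrow> nat" assume "\<alpha> \<in> multidegrees D"
    then have "\<alpha> i \<le> D" for i
      using member_le_sum[of i UNIV \<alpha>] by (force simp: multidegrees_def)
    then show "\<alpha> \<in> UNIV \<rightarrow>\<^sub>E {..D}" by auto
  qed
qed (auto intro: finite_PiE)

definition polys_le :: "nat \<Rightarrow> (real ^ 'n \<Rightarrow> real) set" where
  "polys_le D =
     {f. \<exists>c :: ('n \<Rightarrow> nat) \<Rightarrow> real.
           f = (\<lambda>y. \<Sum>\<alpha>\<in>multidegrees D. c \<alpha> * (\<Prod>i\<in>UNIV. (y $ i) ^ \<alpha> i))}"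

text \<open>
  Both suprema are taken in the extended reals, over those \<open>f\<close> for which the expectation in the
  numerator exists and is finite and \<open>0 < E\<^sub>Q[f(Y)\<^sup>2] < \<infinity>\<close>. The integrability conditions are
  explicit because the integral of a non-integrable function is \<open>0\<close>. The non-zero constants are
  always admissible, so the suprema are over non-empty sets.
\<close>

definition Adv ::
  "nat \<Rightarrow> ('a \<times> (real ^ 'n)) measure \<Rightarrow> ('a \<times> (real ^ 'n)) measure \<Rightarrow> ereal" where
  "Adv D P Q =
     (SUP f \<in> {f \<in> polys_le D.
                 integrable P (\<lambda>z. f (snd z)) \<and>
                 integrable Q (\<lambda>z. (f (snd z))\<^sup>2) \<and> 0 < (\<integral>z. (f (snd z))\<^sup>2 \<partial>Q)}.
        ereal ((\<integral>z. f (snd z) \<partial>P) / sqrt (\<integral>z. (f (snd z))\<^sup>2 \<partial>Q)))"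

definition Corr' ::
  "nat \<Rightarrow> ('a \<Rightarrow> real) \<Rightarrow> ('a \<times> (real ^ 'n)) measure \<Rightarrow> ereal" where
  "Corr' D g Q =
     ereal (1 / (\<integral>z. g (fst z) \<partial>Q)) *
     (SUP f \<in> {f \<in> polys_le D.
                 integrable Q (\<lambda>z. g (fst z) * f (snd z)) \<and>
                 integrable Q (\<lambda>z. (f (snd z))\<^sup>2) \<and> 0 < (\<integral>z. (f (snd z))\<^sup>2 \<partial>Q)}.
        ereal ((\<integral>z. g (fst z) * f (snd z) \<partial>Q) / sqrt (\<integral>z. (f (snd z))\<^sup>2 \<partial>Q)))"

end

theory Submission
  imports Defs
begin

text \<open>
  In both parts \<open>P\<close> is the tilt of \<open>Q\<close> by a normalised function of the signal,
  \<open>dP/dQ (x, y) = g x / E\<^sub>Q[g(X)]\<close>. In the first part this is the definition of \<open>P\<close>; in the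
  second one it holds with \<open>g = l\<close> because a joint law is determined by its signal marginal and
  the conditional law of \<open>Y\<close> given \<open>X\<close>. For such \<open>P\<close> the numerators satisfy
  \<open>E\<^sub>P[f(Y)] = E\<^sub>Q[g(X) f(Y)] / E\<^sub>Q[g(X)]\<close> for every \<open>f\<close>, so the two suprema agree term by term.
\<close>

section \<open>Projections and the signal marginal of a tilted law\<close>

lemma measurable_fst_sets:
  "sets J = sets (S \<Otimes>\<^sub>M N) \<Longrightarrow> fst \<in> measurable J S"
  by (subst measurable_cong_sets[of J "S \<Otimes>\<^sub>M N" S S]) auto

lemma measurable_snd_sets:
  "sets J = sets (S \<Otimes>\<^sub>M N) \<Longrightarrow> snd \<in> measurable J N"
  by (subst measurable_cong_sets[of J "S \<Otimes>\<^sub>M N" N N]) auto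

lemma law_X_density:
  assumes "sets J = sets (S \<Otimes>\<^sub>M N)" "h \<in> borel_measurable S"
  shows "law_X S (density J (\<lambda>z. h (fst z))) = density (law_X S J) h"
  unfolding law_X_def
  using density_distr[OF assms(2) measurable_fst_sets[OF assms(1)]] by simp

section \<open>Stability of the discrete-or-density condition\<close>

lemma discrete_or_density_density:
  assumes "discrete_or_density R M" "sets M = sets R" "h \<in> borel_measurable R"
  shows "discrete_or_density R (density M h)"
proof -
  have h: "h \<in> borel_measurable M"
    using assms(2,3) by (simp cong: measurable_cong_sets)
  show ?thesis
    using assms(1) unfolding discrete_or_density_def
  proof (elim disjE bexE)
    assume "discrete_distr M"
    then have "discrete_distr (density M h)"
      unfolding discrete_distr_def by (auto simp: AE_density[OF h])
    then show "discrete_distr (density M h) \<or> (\<exists>p\<in>borel_measurable R. density M h = density R p)" ..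
  next
    fix p assume p: "p \<in> borel_measurable R" "M = density R p"
    then have "density M h = density R (\<lambda>x. p x * h x)"
      using assms(3) by (simp add: density_density_eq)
    then show "discrete_distr (density M h) \<or> (\<exists>p\<in>borel_measurable R. density M h = density R p)"
      using p(1) assms(3) by auto
  qed
qed

text \<open>Meant for the law of \<open>Y\<close>: after a tilt in \<open>X\<close>, its density is
  a conditional expectation given \<open>Y\<close>, but absolute continuity is all that is needed. A
  countable carrier keeps full measure, and in the density case Radon-Nikodym over \<open>R\<close>
  applies by transitivity.\<close>

lemma discrete_or_density_absolutely_continuous:
  assumes "discrete_or_density R M" "sets M = sets R" "sets M' = sets R"
    and "sigma_finite_measure R" "absolutely_continuous M M'"
  shows "discrete_or_density R M'"
  using assms(1) unfolding discrete_or_density_def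
proof (elim disjE bexE)
  assume "discrete_distr M"
  then obtain A where A: "countable A" "\<forall>a\<in>A. {a} \<in> sets M" "AE x in M. x \<in> A"
    by (auto simp: discrete_distr_def)
  have "AE x in M'. x \<in> A"
    using absolutely_continuous_AE[OF _ assms(5) A(3)] assms(2,3) by simp
  then have "discrete_distr M'"
    using A assms(2,3) unfolding discrete_distr_def by auto
  then show "discrete_distr M' \<or> (\<exists>p\<in>borel_measurable R. M' = density R p)" ..
next
  fix p assume "p \<in> borel_measurable R" "M = density R p"
  then have "absolutely_continuous R M"
    by (simp add: absolutely_continuousI_density)
  with assms(5) have "absolutely_continuous R M'"
    by (auto simp: absolutely_continuous_def)
  with sigma_finite_measure.Radon_Nikodym[OF assms(4) this assms(3)]
  show "discrete_distr M' \<or> (\<exists>p\<in>borel_measurable R. M' = density R p)"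
    by auto
qed

lemma absolutely_continuous_distr_density:
  assumes "T \<in> measurable M N" "h \<in> borel_measurable M"
  shows "absolutely_continuous (distr M N T) (distr (density M h) N T)"
  unfolding absolutely_continuous_def
proof
  fix A assume "A \<in> null_sets (distr M N T)"
  then have A: "A \<in> sets N" "T -` A \<inter> space M \<in> null_sets M"
    using assms(1) by (auto simp: null_sets_def emeasure_distr)
  have "T -` A \<inter> space M \<in> null_sets (density M h)"
    using absolutely_continuousI_density[OF assms(2)] A(2)
    by (auto simp: absolutely_continuous_def)
  then show "A \<in> null_sets (distr (density M h) N T)"
    using A(1) assms(1) by (auto simp: null_sets_def emeasure_distr)
qed

section \<open>Conditional laws of the observation given the signal\<close>

lemma measurable_cond_law_emeasure:
  assumes "cond_law S J \<kappa>" "B \<in> sets borel"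
  shows "(\<lambda>x. emeasure (\<kappa> x) B) \<in> borel_measurable S"
proof -
  have "\<kappa> \<in> measurable S (subprob_algebra borel)"
    using assms(1) by (simp add: cond_law_def measurable_prob_algebraD)
  from measurable_compose[OF this measurable_emeasure_subprob_algebra[OF assms(2)]]
  show ?thesis by simp
qed

text \<open>
  For fixed \<open>B\<close>, the defining property of \<open>\<kappa>\<close> says that the measure \<open>A \<mapsto> J(A \<times> B)\<close> has
  density \<open>x \<mapsto> \<kappa> x B\<close> with respect to the law of \<open>X\<close>, which extends the property from indicators
  to all \<open>h\<close>.
\<close>

lemma nn_integral_cond_law:
  assumes J: "sets J = sets (S \<Otimes>\<^sub>M borel)" and \<kappa>: "cond_law S J \<kappa>"
    and B: "B \<in> sets borel" and h: "h \<in> borel_measurable S"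
  shows "(\<integral>\<^sup>+z. h (fst z) * indicator B (snd z) \<partial>J) = (\<integral>\<^sup>+x. h x * emeasure (\<kappa> x) B \<partial>law_X S J)"
proof -
  note [measurable] = measurable_fst_sets[OF J] measurable_snd_sets[OF J] B h
    measurable_cond_law_emeasure[OF \<kappa> B]
  have sp: "space J = space S \<times> UNIV"
    using sets_eq_imp_space_eq[OF J] by (simp add: space_pair_measure)
  have sX[measurable_cong]: "sets (law_X S J) = sets S" by (simp add: law_X_def)
  have "distr (density J (\<lambda>z. indicator B (snd z))) S fst
      = density (law_X S J) (\<lambda>x. emeasure (\<kappa> x) B)"
  proof (rule measure_eqI)
    fix A assume "A \<in> sets (distr (density J (\<lambda>z. indicator B (snd z))) S fst)"
    then have A[measurable]: "A \<in> sets S" by simp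
    have AB: "A \<times> B \<in> sets J" using A B J by simp
    have "emeasure (distr (density J (\<lambda>z. indicator B (snd z))) S fst) A
        = (\<integral>\<^sup>+z. indicator B (snd z) * indicator (fst -` A \<inter> space J) z \<partial>J)"
      by (subst emeasure_distr) (auto simp: emeasure_density)
    also have "\<dots> = (\<integral>\<^sup>+z. indicator (A \<times> B) z \<partial>J)"
      by (rule nn_integral_cong) (auto simp: indicator_def)
    also have "\<dots> = (\<integral>\<^sup>+x. emeasure (\<kappa> x) B * indicator A x \<partial>law_X S J)"
      using \<kappa> A B AB by (simp add: cond_law_def)
    also have "\<dots> = emeasure (density (law_X S J) (\<lambda>x. emeasure (\<kappa> x) B)) A"
      by (subst emeasure_density) auto
    finally show "emeasure (distr (density J (\<lambda>z. indicator B (snd z))) S fst) A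
        = emeasure (density (law_X S J) (\<lambda>x. emeasure (\<kappa> x) B)) A" .
  qed (simp add: sX)
  then have "(\<integral>\<^sup>+x. h x \<partial>distr (density J (\<lambda>z. indicator B (snd z))) S fst)
      = (\<integral>\<^sup>+x. h x \<partial>density (law_X S J) (\<lambda>x. emeasure (\<kappa> x) B))" by simp
  then show ?thesis
    by (simp add: nn_integral_distr nn_integral_density mult.commute)
qed

text \<open>The weight depends on the signal only, so it can be absorbed, together with
  \<open>indicator A\<close>, into the test function of \<open>nn_integral_cond_law\<close>.\<close>

lemma emeasure_density_cond_law:
  assumes J: "sets J = sets (S \<Otimes>\<^sub>M borel)" and \<kappa>: "cond_law S J \<kappa>"
    and A: "A \<in> sets S" and B: "B \<in> sets borel" and h: "h \<in> borel_measurable S"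
  shows "emeasure (density J (\<lambda>z. h (fst z))) (A \<times> B)
    = (\<integral>\<^sup>+x\<in>A. emeasure (\<kappa> x) B \<partial>density (law_X S J) h)"
proof -
  note [measurable] = measurable_fst_sets[OF J] measurable_snd_sets[OF J] A B h
    measurable_cond_law_emeasure[OF \<kappa> B]
  have [measurable_cong]: "sets (law_X S J) = sets S" by (simp add: law_X_def)
  have AB: "A \<times> B \<in> sets J" using A B J by simp
  have "emeasure (density J (\<lambda>z. h (fst z))) (A \<times> B)
      = (\<integral>\<^sup>+z. h (fst z) * indicator (A \<times> B) z \<partial>J)"
    using AB by (subst emeasure_density) auto
  also have "\<dots> = (\<integral>\<^sup>+z. (h (fst z) * indicator A (fst z)) * indicator B (snd z) \<partial>J)"
    by (rule nn_integral_cong) (auto simp: indicator_def split: if_splits)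
  also have "\<dots> = (\<integral>\<^sup>+x. (h x * indicator A x) * emeasure (\<kappa> x) B \<partial>law_X S J)"
    by (rule nn_integral_cond_law[OF J \<kappa> B]) measurable
  also have "\<dots> = (\<integral>\<^sup>+x\<in>A. emeasure (\<kappa> x) B \<partial>density (law_X S J) h)"
    by (subst nn_integral_density) (auto simp: ac_simps intro!: nn_integral_cong)
  finally show ?thesis .
qed

text \<open>The weight is constant on each fibre over a signal \<open>x\<close>, so it only
  reweights the signals and leaves the channel from \<open>X\<close> to \<open>Y\<close>
  intact.\<close>

lemma cond_law_density:
  assumes "sets J = sets (S \<Otimes>\<^sub>M borel)" "cond_law S J \<kappa>" "h \<in> borel_measurable S"
  shows "cond_law S (density J (\<lambda>z. h (fst z))) \<kappa>"
  using assms emeasure_density_cond_law[OF assms(1,2) _ _ assms(3)]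
  by (auto simp: cond_law_def law_X_density)

text \<open>On rectangles both measures are the same integral of \<kappa> against the common signal
  law, and rectangles form an intersection-stable generator.\<close>

lemma cond_law_unique:
  assumes P: "finite_measure P" "sets P = sets (S \<Otimes>\<^sub>M borel)" "cond_law S P \<kappa>"
    and P': "sets P' = sets (S \<Otimes>\<^sub>M borel)" "cond_law S P' \<kappa>"
    and X: "law_X S P = law_X S P'"
  shows "P = P'"
proof (rule measure_eqI_generator_eq)
  let ?E = "{A \<times> B | A B. A \<in> sets S \<and> B \<in> sets borel}"
  let ?\<Omega> = "space S \<times> (UNIV :: (real ^ 'b) set)"
  show "Int_stable ?E" by (rule Int_stable_pair_measure_generator)
  show "?E \<subseteq> Pow ?\<Omega>" using sets.sets_into_space by fastforce
  show "sets P = sigma_sets ?\<Omega> ?E" "sets P' = sigma_sets ?\<Omega> ?E"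
    using P(2) P'(1) by (simp_all add: sets_pair_measure)
  show "emeasure P Z = emeasure P' Z" if "Z \<in> ?E" for Z
    using that P(3) P'(2) X by (auto simp: cond_law_def)
  \<comment> \<open>The whole space is itself a rectangle, so a constant sequence serves as the
    exhaustion by sets of finite measure.\<close>
  have "UNIV \<in> sets (borel :: (real ^ 'b) measure)" by simp
  then have "?\<Omega> \<in> ?E" using sets.top[of S] by blast
  then show "range (\<lambda>_::nat. ?\<Omega>) \<subseteq> ?E" by blast
  show "(\<Union>i::nat. ?\<Omega>) = ?\<Omega>" by auto
  show "emeasure P ?\<Omega> \<noteq> \<infinity>"
    using finite_measure.emeasure_finite[OF P(1)] by auto
qed

text \<open>Makes the tilted law an admissible witness in the first part. Its signal marginal has
  the explicit density \<open>h\<close>, its \<open>Y\<close> marginal is handled by absolute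
  continuity, and its kernel is that of \<open>Q\<close>.\<close>

lemma planted_distr_density:
  assumes Q: "planted_distr S Q" and h: "h \<in> borel_measurable S"
    and prob: "prob_space (density Q (\<lambda>z. h (fst z)))"
  shows "planted_distr S (density Q (\<lambda>z. h (fst z)))"
proof -
  let ?P = "density Q (\<lambda>z. h (fst z))"
  have J: "sets Q = sets (S \<Otimes>\<^sub>M borel)" using Q by (simp add: planted_distr_def)
  note [measurable] = measurable_fst_sets[OF J] measurable_snd_sets[OF J] h
  obtain \<kappa> where \<kappa>: "cond_law S Q \<kappa>" "\<forall>x\<in>space S. discrete_or_density lborel (\<kappa> x)"
    using Q by (auto simp: planted_distr_def)
  have "discrete_or_density S (law_X S ?P)"
    using Q h unfolding law_X_density[OF J h]
    by (intro discrete_or_density_density) (auto simp: planted_distr_def law_X_def)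
  moreover have "discrete_or_density lborel (law_Y ?P)"
  proof (rule discrete_or_density_absolutely_continuous)
    show "discrete_or_density lborel (law_Y Q)" using Q by (simp add: planted_distr_def)
    show "absolutely_continuous (law_Y Q) (law_Y ?P)"
      unfolding law_Y_def by (rule absolutely_continuous_distr_density) measurable
  qed (auto simp: law_Y_def sigma_finite_lborel)
  ultimately show ?thesis
    using prob J cond_law_density[OF J \<kappa>(1) h] \<kappa>(2) unfolding planted_distr_def by auto
qed

section \<open>Comparison of the two suprema\<close>

lemma ereal_mult_SUP_pos:
  fixes F :: "'i \<Rightarrow> ereal"
  assumes "0 < c"
  shows "ereal c * (SUP i\<in>I. F i) = (SUP i\<in>I. ereal c * F i)"
proof (rule antisym)
  \<comment> \<open>Division by \<open>c\<close> is a monotone inverse of multiplication by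
    \<open>c\<close>, so bounding each term suffices, even if the supremum is infinite or
    \<open>I\<close> is empty.\<close>
  have "(SUP i\<in>I. F i) \<le> (SUP i\<in>I. ereal c * F i) / ereal c"
    using assms by (intro SUP_least) (auto simp: ereal_le_divide_pos intro!: SUP_upper)
  then show "ereal c * (SUP i\<in>I. F i) \<le> (SUP i\<in>I. ereal c * F i)"
    using assms by (simp add: ereal_le_divide_pos)
  show "(SUP i\<in>I. ereal c * F i) \<le> ereal c * (SUP i\<in>I. F i)"
    using assms by (intro SUP_least ereal_mult_left_mono SUP_upper) auto
qed

lemma measurable_polys_le: "f \<in> polys_le D \<Longrightarrow> f \<in> borel_measurable borel"
  by (auto simp: polys_le_def)

lemma Adv_density_eq_Corr':
  assumes J: "sets Q = sets (S \<Otimes>\<^sub>M borel)"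
    and g[measurable]: "g \<in> borel_measurable S" and nonneg: "\<forall>x\<in>space S. 0 \<le> g x"
    and c: "c = (\<integral>z. g (fst z) \<partial>Q)" "0 < c"
  shows "Adv D (density Q (\<lambda>z. ennreal (g (fst z) / c))) Q = Corr' D g Q"
proof -
  let ?P = "density Q (\<lambda>z. ennreal (g (fst z) / c))"
  note [measurable] = measurable_fst_sets[OF J] measurable_snd_sets[OF J]
  have "space Q = space S \<times> UNIV"
    using sets_eq_imp_space_eq[OF J] by (simp add: space_pair_measure)
  \<comment> \<open>\<open>ennreal\<close> sends negative reals to 0, so the real-valued density
    formulas below require this sign condition.\<close>
  then have AE: "AE z in Q. 0 \<le> g (fst z) / c"
    using nonneg c(2) by (intro AE_I2) auto
  \<comment> \<open>\<open>int\<close> makes the two sets of admissible polynomials coincide;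
    \<open>eq\<close> identifies the numerators up to the prefactor \<open>1 / c\<close> of
    \<open>Corr'\<close>.\<close>
  have int: "integrable ?P (\<lambda>z. f (snd z)) \<longleftrightarrow> integrable Q (\<lambda>z. g (fst z) * f (snd z))"
    and eq: "(\<integral>z. f (snd z) \<partial>?P) = 1 / c * (\<integral>z. g (fst z) * f (snd z) \<partial>Q)"
    if "f \<in> polys_le D" for f
  proof -
    note [measurable] = measurable_polys_le[OF that]
    have "integrable ?P (\<lambda>z. f (snd z)) \<longleftrightarrow> integrable Q (\<lambda>z. g (fst z) / c * f (snd z))"
      using AE by (subst integrable_density) auto
    also have "\<dots> \<longleftrightarrow> integrable Q (\<lambda>z. g (fst z) * f (snd z))"
      using c(2) integrable_mult_left_iff[where c = "1 / c" and M = Q and f = "\<lambda>z. g (fst z) * f (snd z)"] by simp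
    finally show "integrable ?P (\<lambda>z. f (snd z)) \<longleftrightarrow> integrable Q (\<lambda>z. g (fst z) * f (snd z))" .
    have "(\<integral>z. f (snd z) \<partial>?P) = (\<integral>z. g (fst z) / c * f (snd z) \<partial>Q)"
      using AE by (subst integral_density) auto
    then show "(\<integral>z. f (snd z) \<partial>?P) = 1 / c * (\<integral>z. g (fst z) * f (snd z) \<partial>Q)" by simp
  qed
  show ?thesis
    unfolding Adv_def Corr'_def c(1)[symmetric]
    using c(2) by (subst ereal_mult_SUP_pos) (auto simp: int eq intro!: SUP_cong)
qed

theorem proposition2p6:
  fixes S :: "'a measure" and D :: nat
  shows
    "(\<forall>(Q :: ('a \<times> (real ^ 'n)) measure) (g :: 'a \<Rightarrow> real).
        planted_distr S Q \<and>
        g \<in> borel_measurable S \<and> (\<forall>x\<in>space S. 0 \<le> g x) \<and>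
        integrable Q (\<lambda>z. g (fst z)) \<and> 0 < (\<integral>z. g (fst z) \<partial>Q) \<longrightarrow>
        (\<exists>P :: ('a \<times> (real ^ 'n)) measure.
           planted_distr S P \<and> Adv D P Q = Corr' D g Q)) \<and>
     (\<forall>(P :: ('a \<times> (real ^ 'n)) measure) (Q :: ('a \<times> (real ^ 'n)) measure) (l :: 'a \<Rightarrow> real).
        planted_distr S P \<and> planted_distr S Q \<and>
        likelihood_ratio_X S P Q l \<and>
        (\<exists>\<kappa>. cond_law S P \<kappa> \<and> cond_law S Q \<kappa>) \<longrightarrow>
        Adv D P Q = Corr' D l Q)"
proof (intro conjI allI impI; elim conjE exE)
  fix Q :: "('a \<times> (real ^ 'n)) measure" and g :: "'a \<Rightarrow> real"
  assume Q: "planted_distr S Q" and g[measurable]: "g \<in> borel_measurable S"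
    and nonneg: "\<forall>x\<in>space S. 0 \<le> g x" and int: "integrable Q (\<lambda>z. g (fst z))"
    and pos: "0 < (\<integral>z. g (fst z) \<partial>Q)"
  define c where "c = (\<integral>z. g (fst z) \<partial>Q)"
  have J: "sets Q = sets (S \<Otimes>\<^sub>M borel)" using Q by (simp add: planted_distr_def)
  note [measurable] = measurable_fst_sets[OF J]
  have sp: "space Q = space S \<times> UNIV"
    using sets_eq_imp_space_eq[OF J] by (simp add: space_pair_measure)
  \<comment> \<open>Total mass of the tilt: integrability of \<open>g\<close> allows passing to the
    real integral, where \<open>c\<close> cancels.\<close>
  have "(\<integral>\<^sup>+z. ennreal (g (fst z) / c) \<partial>Q) = ennreal (\<integral>z. g (fst z) / c \<partial>Q)"
    using int nonneg pos by (intro nn_integral_eq_integral AE_I2) (auto simp: sp c_def)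
  also have "\<dots> = 1" using pos by (simp add: c_def)
  finally have "prob_space (density Q (\<lambda>z. ennreal (g (fst z) / c)))"
    by (intro prob_spaceI) (simp add: emeasure_density cong: nn_integral_cong)
  then have "planted_distr S (density Q (\<lambda>z. ennreal (g (fst z) / c)))"
    by (intro planted_distr_density[OF Q, of "\<lambda>x. ennreal (g x / c)"]) auto
  moreover have "Adv D (density Q (\<lambda>z. ennreal (g (fst z) / c))) Q = Corr' D g Q"
    using Adv_density_eq_Corr'[OF J g nonneg c_def] pos by (simp add: c_def)
  ultimately show "\<exists>P :: ('a \<times> (real ^ 'n)) measure. planted_distr S P \<and> Adv D P Q = Corr' D g Q"
    by blast
next
  fix P Q :: "('a \<times> (real ^ 'n)) measure" and l :: "'a \<Rightarrow> real" and \<kappa>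
  assume P: "planted_distr S P" and Q: "planted_distr S Q" and l: "likelihood_ratio_X S P Q l"
    and \<kappa>: "cond_law S P \<kappa>" "cond_law S Q \<kappa>"
  have JP: "sets P = sets (S \<Otimes>\<^sub>M borel)" and J: "sets Q = sets (S \<Otimes>\<^sub>M borel)"
    and probP: "prob_space P"
    using P Q by (simp_all add: planted_distr_def)
  have l_meas[measurable]: "l \<in> borel_measurable S" and nonneg: "\<forall>x\<in>space S. 0 \<le> l x"
    and lX: "law_X S P = density (law_X S Q) (\<lambda>x. ennreal (l x))"
    using l by (simp_all add: likelihood_ratio_X_def)
  note [measurable] = measurable_fst_sets[OF J]
  have sp: "space Q = space S \<times> UNIV"
    using sets_eq_imp_space_eq[OF J] by (simp add: space_pair_measure)
  have l': "(\<lambda>x. ennreal (l x)) \<in> borel_measurable S" by measurable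
  \<comment> \<open>The tilt of \<open>Q\<close> by \<open>l\<close> has the signal law of
    \<open>P\<close> by the likelihood ratio, and it keeps the shared kernel \<kappa>, so uniqueness
    applies.\<close>
  have P_eq: "P = density Q (\<lambda>z. ennreal (l (fst z)))"
    using probP JP \<kappa>(1) J cond_law_density[OF J \<kappa>(2) l'] law_X_density[OF J l'] lX
    by (intro cond_law_unique[of P S \<kappa>]) (auto simp: prob_space_def)
  \<comment> \<open>The normalising constant is 1, being the total mass of \<open>P\<close>. Working
    first with the nonnegative integral avoids presupposing that \<open>l\<close> is
    integrable.\<close>
  have "(\<integral>\<^sup>+z. ennreal (l (fst z)) \<partial>Q) = emeasure P (space P)"
    unfolding P_eq by (simp add: emeasure_density cong: nn_integral_cong)
  also have "\<dots> = 1" by (rule prob_space.emeasure_space_1[OF probP])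
  finally have "(\<integral>z. l (fst z) \<partial>Q) = 1"
    using nonneg by (subst integral_eq_nn_integral) (auto simp: sp)
  then show "Adv D P Q = Corr' D l Q"
    using Adv_density_eq_Corr'[OF J l_meas nonneg, of 1] P_eq by simp
qed

end
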